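(* For every $t\in\mathbb{N}$ there exist a graph $G_t$ and a circular drawing $D$ of $G_t$ such that $G_t$ contains a $K_t$-minor, $G_t$ has maximum degree $3$, and the crossing graph $X_D$ is $2$-degenerate.
   Context: A circular drawing of a graph $G$ places the vertices at distinct points on a circle and draws each edge as the straight line segment between its endpoints. Two edges cross if their segments intersect at a point that is not an endpoint of either. The crossing graph $X_D$ has vertex set $E(G)$, two edges adjacent iff they cross in $D$. A graph is $2$-degenerate if every nonempty subgraph has a vertex of degree at most $2$. *)

theory Defs
  imports "HOL-Analysis.Analysis"
begin

datatype 'a ugraph = Graph (verts: "'a set") (edges: "'a set set")

definition simple_graph :: "'a ugraph \<Rightarrow> bool" where
  "simple_graph G \<longleftrightarrow> finite (verts G) \<and> (\<forall>e \<in> edges G. e \<subseteq> verts G \<and> card e = 2)"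

definition subgraph :: "'a ugraph \<Rightarrow> 'a ugraph \<Rightarrow> bool" where
  "subgraph H G \<longleftrightarrow> simple_graph H \<and> verts H \<subseteq> verts G \<and> edges H \<subseteq> edges G"

definition graph_iso :: "'a ugraph \<Rightarrow> 'b ugraph \<Rightarrow> bool" where
  "graph_iso G H \<longleftrightarrow> (\<exists>f. bij_betw f (verts G) (verts H) \<and> edges H = (\<lambda>e. f ` e) ` edges G)"

definition complete_graph :: "nat \<Rightarrow> nat ugraph" where
  "complete_graph t = Graph {..<t} {e. e \<subseteq> {..<t} \<and> card e = 2}"

definition vertex_degree :: "'a ugraph \<Rightarrow> 'a \<Rightarrow> nat" where
  "vertex_degree G v = card {e \<in> edges G. v \<in> e}"

text \<open>The \<open>insert 0\<close> only matters for the graph without vertices.\<close>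

definition max_degree :: "'a ugraph \<Rightarrow> nat" where
  "max_degree G = Max (insert 0 (vertex_degree G ` verts G))"

definition degenerate :: "nat \<Rightarrow> 'a ugraph \<Rightarrow> bool" where
  "degenerate d G \<longleftrightarrow>
     (\<forall>H. subgraph H G \<and> verts H \<noteq> {} \<longrightarrow> (\<exists>v \<in> verts H. vertex_degree H v \<le> d))"

text \<open>Contracting the edge \<open>{u, v}\<close> merges \<open>v\<close> into \<open>u\<close>; the loop \<open>{u}\<close> is discarded, and
  parallel edges coincide because edges form a set.\<close>

definition contract_edge :: "'a \<Rightarrow> 'a \<Rightarrow> 'a ugraph \<Rightarrow> 'a ugraph" where
  "contract_edge u v G =
     Graph (verts G - {v}) ((\<lambda>e. (\<lambda>w. if w = v then u else w) ` e) ` edges G - {{u}})"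

inductive contracts_to :: "'a ugraph \<Rightarrow> 'a ugraph \<Rightarrow> bool" for G where
  refl: "contracts_to G G"
| step: "contracts_to G (contract_edge u v H)"
    if "contracts_to G H" "{u, v} \<in> edges H" "u \<noteq> v"

definition is_minor :: "'a ugraph \<Rightarrow> 'b ugraph \<Rightarrow> bool" where
  "is_minor H G \<longleftrightarrow> (\<exists>S K. subgraph S G \<and> contracts_to S K \<and> graph_iso H K)"

text \<open>A circular drawing is given by the positions of the vertices in the plane; the edges are then
  determined as straight line segments.\<close>

definition circular_drawing :: "'a ugraph \<Rightarrow> ('a \<Rightarrow> complex) \<Rightarrow> bool" where
  "circular_drawing G D \<longleftrightarrow>
     inj_on D (verts G) \<and> (\<exists>c r. r > 0 \<and> D ` verts G \<subseteq> sphere c r)"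

definition edges_cross :: "('a \<Rightarrow> complex) \<Rightarrow> 'a set \<Rightarrow> 'a set \<Rightarrow> bool" where
  "edges_cross D e f \<longleftrightarrow> e \<noteq> f \<and>
     (\<exists>u v x y z. e = {u, v} \<and> f = {x, y} \<and>
        z \<in> closed_segment (D u) (D v) \<and> z \<in> closed_segment (D x) (D y) \<and>
        z \<notin> {D u, D v, D x, D y})"

definition crossing_graph :: "'a ugraph \<Rightarrow> ('a \<Rightarrow> complex) \<Rightarrow> 'a set ugraph" where
  "crossing_graph G D =
     Graph (edges G) {{e, f} | e f. e \<in> edges G \<and> f \<in> edges G \<and> edges_cross D e f}"

end

theory Submission
  imports Defs
begin

text \<open>Place the natural numbers in their usual order on a circle and join each \<open>n\<close> with
  \<open>2\<close>-adic valuation \<open>k\<close> to \<open>n \<plusminus> 2\<^bsup>k + 1\<^esup>\<close>. Strictly between the ends of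
  such an edge the only vertex of valuation at least \<open>k\<close> is the midpoint, which has just two such
  edges. Hence an edge of smallest valuation in a set of edges crosses at most two others of the set,
  while an edge \<open>{n, n + 1}\<close> crosses nothing.

  The vertices of valuation \<open>k + 1\<close> form a path, the \<open>k\<close>-th spine. For \<open>i < j\<close> a private
  interval of the circle is reserved in which spines \<open>i\<close> and \<open>j\<close> are linked by a path
  \<open>b, b + 1, b + 3, \<dots>, a - 1, a\<close> through odd numbers. Only the ends of the links have degree \<open>3\<close>,
  and contracting the spines together with the links gives a complete graph.\<close>

section \<open>Points on a circle and crossing chords\<close>

text \<open>The inversion in the unit circle of the point \<open>1 + i n\<close>; the vertical line
  through 1 becomes the circle with diameter from 0 to 1. Coordinates are rational, and increasing
  \<open>n\<close> moves along the upper arc in one direction.\<close>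

definition circle_point :: "nat \<Rightarrow> complex" where
  "circle_point n = Complex (1 / (1 + (real n)\<^sup>2)) (real n / (1 + (real n)\<^sup>2))"

lemma circle_point_in_sphere: "circle_point n \<in> sphere (Complex (1/2) 0) (1/2)"
proof -
  define s where "s = real n"
  have pos: "1 + s\<^sup>2 > 0" by (simp add: add_pos_nonneg)
  have "(1/2 - 1 / (1 + s\<^sup>2))\<^sup>2 + (s / (1 + s\<^sup>2))\<^sup>2 = (1/2)\<^sup>2"
    using pos by (simp add: divide_simps) algebra
  then have "cmod (Complex (1/2 - 1 / (1 + s\<^sup>2)) (- (s / (1 + s\<^sup>2)))) = sqrt ((1/2)\<^sup>2)"
    by (simp only: complex_norm power2_minus)
  then have "cmod (Complex (1/2 - 1 / (1 + s\<^sup>2)) (- (s / (1 + s\<^sup>2)))) = 1/2"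
    by (simp only: real_sqrt_abs)
  then show ?thesis
    by (simp add: circle_point_def dist_norm s_def minus_complex.ctr)
qed

lemma inj_circle_point: "inj circle_point"
proof (rule injI)
  fix m n :: nat
  assume "circle_point m = circle_point n"
  then have 1: "1 / (1 + (real m)\<^sup>2) = 1 / (1 + (real n)\<^sup>2)"
    by (simp add: circle_point_def)
  then have "(real m)\<^sup>2 = (real n)\<^sup>2" by simp
  then show "m = n" by simp
qed

text \<open>The affine function vanishing on the line through the points \<open>u\<close> and \<open>v\<close>; on the
  circle its sign is that of \<open>(s - u) (s - v)\<close>.\<close>

definition chord_side :: "nat \<Rightarrow> nat \<Rightarrow> complex \<Rightarrow> real" where
  "chord_side u v z = 1 - (real u + real v) * Im z + (real u * real v - 1) * Re z"

lemma chord_side_circle_point: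
  "chord_side u v (circle_point s) = (real s - real u) * (real s - real v) / (1 + (real s)\<^sup>2)"
proof -
  define N where "N = 1 + (real s)\<^sup>2"
  have "N > 0" by (simp add: N_def add_pos_nonneg)
  then have "chord_side u v (circle_point s) =
      (N - (real u + real v) * real s + (real u * real v - 1)) / N"
    by (simp add: chord_side_def circle_point_def N_def[symmetric] diff_divide_distrib add_divide_distrib)
  also have "N - (real u + real v) * real s + (real u * real v - 1) =
      (real s - real u) * (real s - real v)"
    by (simp add: N_def algebra_simps power2_eq_square)
  finally show ?thesis by (simp add: N_def)
qed

lemma chord_side_affine:
  "chord_side u v ((1 - c) *\<^sub>R p + c *\<^sub>R q) = (1 - c) * chord_side u v p + c * chord_side u v q"
  by (simp add: chord_side_def algebra_simps)

text \<open>If no end of \<open>f\<close> lay strictly between \<open>u\<close> and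
  \<open>v\<close>, both ends would be on the nonnegative side of the chord. The crossing point is a
  proper convex combination of them at which \<open>chord_side\<close> vanishes, so it would vanish
  at both ends and \<open>f\<close> would be the chord itself.\<close>

lemma edges_cross_interleave:
  assumes "edges_cross circle_point {u, v} f" "u < v"
  obtains w where "w \<in> f" "u < w" "w < v"
proof -
  obtain u' v' x y z where uv: "{u, v} = {u', v'}" and f: "f = {x, y}" and ne: "{u, v} \<noteq> f"
    and z1: "z \<in> closed_segment (circle_point u') (circle_point v')"
    and z2: "z \<in> closed_segment (circle_point x) (circle_point y)"
    and z3: "z \<notin> {circle_point u', circle_point v', circle_point x, circle_point y}"
    using assms(1) unfolding edges_cross_def by metis
  have z1': "z \<in> closed_segment (circle_point u) (circle_point v)"
    using uv z1 by (auto simp: doubleton_eq_iff closed_segment_commute)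
  let ?g = "chord_side u v"
  have "?g z = 0"
    using z1' by (auto simp: in_segment chord_side_affine chord_side_circle_point)
  obtain c where c: "0 \<le> c" "c \<le> 1" "z = (1 - c) *\<^sub>R circle_point x + c *\<^sub>R circle_point y"
    using z2 by (auto simp: in_segment)
  have "c \<noteq> 0" "c \<noteq> 1" using c(3) z3 by auto
  with c have c01: "0 < c" "c < 1" by auto
  have "x \<noteq> y" using z2 z3 by auto
  have sum0: "(1 - c) * ?g (circle_point x) + c * ?g (circle_point y) = 0"
    using \<open>?g z = 0\<close> c(3) chord_side_affine by simp
  have g_nonneg: "?g (circle_point s) \<ge> 0" and g_pos: "s \<noteq> u \<Longrightarrow> s \<noteq> v \<Longrightarrow> ?g (circle_point s) > 0"
    if "\<not> (u < s \<and> s < v)" for s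
  proof -
    have d: "1 + (real s)\<^sup>2 > 0" by (simp add: add_pos_nonneg)
    from that \<open>u < v\<close> consider "s \<le> u" | "v \<le> s" by linarith
    then have "(real s - real u) * (real s - real v) \<ge> 0"
      using \<open>u < v\<close> by cases (auto intro: mult_nonneg_nonneg mult_nonpos_nonpos)
    then show n: "?g (circle_point s) \<ge> 0"
      using d by (simp add: chord_side_circle_point)
    show "?g (circle_point s) > 0" if "s \<noteq> u" "s \<noteq> v"
    proof -
      have "?g (circle_point s) \<noteq> 0" using that d by (simp add: chord_side_circle_point)
      with n show ?thesis by simp
    qed
  qed
  show thesis
  proof (rule ccontr)
    assume "\<not> thesis"
    then have nx: "\<not> (u < x \<and> x < v)" and ny: "\<not> (u < y \<and> y < v)"
      using that f by auto
    have "?g (circle_point x) = 0" "?g (circle_point y) = 0"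
      using sum0 c01 g_nonneg[OF nx] g_nonneg[OF ny]
      by (smt (verit) mult_nonneg_nonneg mult_pos_pos)+
    then have "x \<in> {u, v}" "y \<in> {u, v}" using g_pos[OF nx] g_pos[OF ny] by auto
    with \<open>x \<noteq> y\<close> ne f show False by auto
  qed
qed

lemma edges_cross_commute: "edges_cross D e f \<longleftrightarrow> edges_cross D f e"
proof -
  have "edges_cross D f e" if "edges_cross D e f" for e f
  proof -
    from that obtain u v x y z where "e \<noteq> f" "e = {u, v}" "f = {x, y}"
      "z \<in> closed_segment (D u) (D v)" "z \<in> closed_segment (D x) (D y)" "z \<notin> {D u, D v, D x, D y}"
      unfolding edges_cross_def by blast
    then show ?thesis
      unfolding edges_cross_def
      by (intro conjI, blast, rule_tac x = x in exI, rule_tac x = y in exI,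
          rule_tac x = u in exI, rule_tac x = v in exI, rule_tac x = z in exI) auto
  qed
  then show ?thesis by blast
qed

text \<open>Every edge of the crossing graph at \<open>e\<close> has the form \<open>{e, f}\<close>
  with \<open>f\<close> crossing \<open>e\<close>, so counting the crossing partners inside
  \<open>H\<close> bounds the degree.\<close>

lemma vertex_degree_crossing_subgraph_le:
  assumes H: "subgraph H (crossing_graph G D)" and "finite F"
    and F: "\<And>f. f \<in> verts H \<Longrightarrow> edges_cross D e f \<Longrightarrow> f \<in> F"
  shows "vertex_degree H e \<le> card F"
proof -
  have "{p \<in> edges H. e \<in> p} \<subseteq> (\<lambda>f. {e, f}) ` F"
  proof
    fix p assume "p \<in> {p \<in> edges H. e \<in> p}"
    then have p: "p \<in> edges H" "e \<in> p" by auto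
    then have "p \<subseteq> verts H" "p \<in> edges (crossing_graph G D)"
      using H by (auto simp: subgraph_def simple_graph_def)
    then obtain a b where ab: "p = {a, b}" "edges_cross D a b"
      by (auto simp: crossing_graph_def)
    with p(2) \<open>p \<subseteq> verts H\<close> obtain f where "p = {e, f}" "edges_cross D e f" "f \<in> verts H"
      using edges_cross_commute by (metis doubleton_eq_iff insert_subset singletonD insertE)
    with F show "p \<in> (\<lambda>f. {e, f}) ` F" by blast
  qed
  then have "card {p \<in> edges H. e \<in> p} \<le> card ((\<lambda>f. {e, f}) ` F)"
    using \<open>finite F\<close> by (intro card_mono) auto
  also have "\<dots> \<le> card F" using \<open>finite F\<close> by (rule card_image_le)
  finally show ?thesis by (simp add: vertex_degree_def)
qed

section \<open>2-adic valuations and degeneracy of the crossing graph\<close>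

text \<open>Valuation exactly \<open>k\<close>, encoded as a residue: invariance under adding
  \<open>2 ^ Suc k\<close> is then immediate, and 0 has no level, whereas
  \<open>multiplicity 2 0\<close> is 0 by convention.\<close>

definition dyadic_level :: "nat \<Rightarrow> nat \<Rightarrow> bool" where
  "dyadic_level k n \<longleftrightarrow> n mod 2 ^ Suc k = 2 ^ k"

lemma dyadic_level_iff: "dyadic_level k n \<longleftrightarrow> (\<exists>q. n = q * 2 ^ Suc k + 2 ^ k)"
proof
  assume "dyadic_level k n"
  then have "n = (n div 2 ^ Suc k) * 2 ^ Suc k + 2 ^ k"
    unfolding dyadic_level_def by (metis div_mult_mod_eq)
  then show "\<exists>q. n = q * 2 ^ Suc k + 2 ^ k" by blast
next
  assume "\<exists>q. n = q * 2 ^ Suc k + 2 ^ k"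
  then show "dyadic_level k n" by (auto simp: dyadic_level_def simp del: power_Suc)
qed

lemma dyadic_level_add: "dyadic_level k (n + 2 ^ Suc k) \<longleftrightarrow> dyadic_level k n"
  by (simp add: dyadic_level_def del: power_Suc)

lemma dyadic_level_dvd: "dyadic_level k n \<Longrightarrow> l \<le> k \<Longrightarrow> 2 ^ l dvd n"
  by (auto simp: dyadic_level_iff le_imp_power_dvd intro!: dvd_add dvd_mult)

lemma dyadic_level_multiplicity:
  assumes "dyadic_level k n"
  shows "multiplicity 2 n = k"
proof -
  obtain q where q: "n = q * 2 ^ Suc k + 2 ^ k" using assms dyadic_level_iff by blast
  then have n: "n = 2 ^ k * (2 * q + 1)" by (simp add: algebra_simps)
  show ?thesis
  proof (rule multiplicity_eqI)
    show "2 ^ k dvd n" by (simp add: n)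
    have "\<not> 2 ^ k * 2 dvd 2 ^ k * (2 * q + 1)"
      by (subst dvd_times_left_cancel_iff) simp_all
    then show "\<not> 2 ^ Suc k dvd n" by (simp only: n power_Suc2 not_False_eq_True)
  qed
qed

lemma degenerate_crossing_graph_dyadic:
  assumes E: "\<And>e. e \<in> edges G \<Longrightarrow>
    (\<exists>n. e = {n, Suc n}) \<or> (\<exists>k n. dyadic_level k n \<and> e = {n, n + 2 ^ Suc k})"
  shows "degenerate 2 (crossing_graph G circle_point)"
  unfolding degenerate_def
proof (intro allI impI)
  fix H assume "subgraph H (crossing_graph G circle_point) \<and> verts H \<noteq> {}"
  then have H: "subgraph H (crossing_graph G circle_point)" and ne: "verts H \<noteq> {}" by auto
  have HG: "verts H \<subseteq> edges G" using H by (simp add: subgraph_def crossing_graph_def)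
  show "\<exists>e\<in>verts H. vertex_degree H e \<le> 2"
  proof (cases "\<exists>n. {n, Suc n} \<in> verts H")
    case True
    then obtain n where n: "{n, Suc n} \<in> verts H" by blast
    \<comment> \<open>No natural number lies strictly between the ends, so nothing crosses this
      edge.\<close>
    have "vertex_degree H {n, Suc n} \<le> card ({} :: nat set set)"
      by (rule vertex_degree_crossing_subgraph_le[OF H])
        (auto elim!: edges_cross_interleave)
    with n show ?thesis by (intro bexI[of _ "{n, Suc n}"]) auto
  next
    case False
    define P where "P k \<longleftrightarrow> (\<exists>n. dyadic_level k n \<and> {n, n + 2 ^ Suc k} \<in> verts H)" for k
    have lev: "\<exists>k n. dyadic_level k n \<and> f = {n, n + 2 ^ Suc k}" if "f \<in> verts H" for f
      using E[of f] HG that False by auto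
    then have "\<exists>k. P k" using ne unfolding P_def by blast
    \<comment> \<open>Only dyadic edges are left in \<open>H\<close>. With \<open>k\<close> their
      least level, all their ends are multiples of \<open>2 ^ k\<close>, and the midpoint
      \<open>c\<close> is the only such multiple strictly inside the chosen edge.\<close>
    define k where "k = (LEAST k. P k)"
    have "P k" unfolding k_def using \<open>\<exists>k. P k\<close> by (rule LeastI_ex)
    then obtain n where n: "dyadic_level k n" "{n, n + 2 ^ Suc k} \<in> verts H"
      by (auto simp: P_def)
    define c where "c = n + 2 ^ k"
    \<comment> \<open>An edge of level \<open>l\<close> with end \<open>c\<close> forces
      \<open>l = multiplicity 2 c\<close>, so its length is \<open>d\<close> and only one candidate
      on each side of \<open>c\<close> remains.\<close>
    define d :: nat where "d = 2 ^ Suc (multiplicity 2 c)"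
    have "vertex_degree H {n, n + 2 ^ Suc k} \<le> card {{c, c + d}, {c - d, c}}"
    proof (rule vertex_degree_crossing_subgraph_le[OF H])
      fix f assume f: "f \<in> verts H" "edges_cross circle_point {n, n + 2 ^ Suc k} f"
      from lev[OF f(1)] obtain l m where m: "dyadic_level l m" "f = {m, m + 2 ^ Suc l}" by blast
      have "k \<le> l" unfolding k_def by (rule Least_le) (use m f(1) in \<open>auto simp: P_def\<close>)
      obtain w where w: "w \<in> f" "n < w" "w < n + 2 ^ Suc k"
        using edges_cross_interleave[OF f(2)] by auto
      have lw: "dyadic_level l w" using w(1) m dyadic_level_add by auto
      have "2 ^ k dvd w" "2 ^ k dvd n"
        using dyadic_level_dvd[OF lw \<open>k \<le> l\<close>] dyadic_level_dvd[OF n(1)] by auto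
      then obtain a b where ab: "w = 2 ^ k * a" "n = 2 ^ k * b" by (auto simp: dvd_def)
      have "2 ^ k * b < 2 ^ k * a" "2 ^ k * a < 2 ^ k * (b + 2)"
        using w ab by (auto simp: algebra_simps)
      then have "b < a" "a < b + 2" by (simp_all only: mult_less_cancel1)
      then have "a = b + 1" by simp
      then have "w = c" using ab by (simp add: c_def)
      then have "d = 2 ^ Suc l" using lw dyadic_level_multiplicity d_def by auto
      then show "f \<in> {{c, c + d}, {c - d, c}}" using w(1) m(2) \<open>w = c\<close> by auto
    qed simp
    also have "\<dots> \<le> 2" by (simp add: card_insert_if)
    finally show ?thesis using n(2) by blast
  qed
qed

section \<open>Complete minors from vertex labellings\<close>

text \<open>The fibres of \<open>f\<close> are connected and any two are joined by an edge.
  Contracting an edge inside a fibre preserves this, because the contraction map does not change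
  labels; once \<open>f\<close> is injective, its inverse is an isomorphism from the complete graph.
  \<open>S\<close> stays fixed while \<open>H\<close> runs through the contractions.\<close>

lemma contracts_to_complete_graph:
  fixes f :: "'a \<Rightarrow> nat"
  assumes "contracts_to S H" "simple_graph H" "f ` verts H = {..<t}"
    and "\<And>u v. u \<in> verts H \<Longrightarrow> v \<in> verts H \<Longrightarrow> f u = f v \<Longrightarrow>
      (u, v) \<in> {(x, y). {x, y} \<in> edges H \<and> f x = f y}\<^sup>*"
    and "\<And>i j. i < j \<Longrightarrow> j < t \<Longrightarrow> \<exists>x y. {x, y} \<in> edges H \<and> f x = i \<and> f y = j"
  shows "\<exists>K. contracts_to S K \<and> graph_iso (complete_graph t) K"
  using assms
proof (induction "card (verts H)" arbitrary: H rule: less_induct)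
  case less
  note simple = less.prems(2) and surj = less.prems(3) and conn = less.prems(4)
    and adj = less.prems(5)
  have fin: "finite (verts H)" using simple by (simp add: simple_graph_def)
  have edgeD: "x \<in> verts H" "y \<in> verts H" "x \<noteq> y" if "{x, y} \<in> edges H" for x y
    using simple that by (fastforce simp: simple_graph_def)+
  show ?case
  proof (cases "inj_on f (verts H)")
    case True
    define g where "g = inv_into (verts H) f"
    have gf: "g (f x) = x" if "x \<in> verts H" for x
      using True that by (simp add: g_def)
    have bij: "bij_betw g {..<t} (verts H)"
      unfolding g_def using True surj by (metis bij_betw_def bij_betw_inv_into)
    have "edges H = (\<lambda>e. g ` e) ` {e. e \<subseteq> {..<t} \<and> card e = 2}"
    proof (intro subset_antisym subsetI)
      fix e assume e: "e \<in> edges H"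
      then have sub: "e \<subseteq> verts H" "card e = 2" using simple by (auto simp: simple_graph_def)
      then have "f ` e \<subseteq> {..<t}" using surj by blast
      moreover have "card (f ` e) = 2"
        using sub True by (simp add: card_image inj_on_subset)
      moreover have "e = g ` (f ` e)" using gf sub by (force simp: image_image)
      ultimately show "e \<in> (\<lambda>e. g ` e) ` {e. e \<subseteq> {..<t} \<and> card e = 2}" by blast
    next
      fix e assume "e \<in> (\<lambda>e. g ` e) ` {e. e \<subseteq> {..<t} \<and> card e = 2}"
      then obtain d where d: "d \<subseteq> {..<t}" "card d = 2" "e = g ` d" by blast
      obtain i j where "d = {i, j}" "i < j"
        using d(2) by (metis card_2_iff insert_commute linorder_neqE_nat)
      moreover obtain x y where "{x, y} \<in> edges H" "f x = i" "f y = j"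
        using adj[of i j] d(1) calculation by auto
      ultimately show "e \<in> edges H" using d(3) gf edgeD by (metis image_empty image_insert)
    qed
    then have "graph_iso (complete_graph t) H"
      using bij by (auto simp: graph_iso_def complete_graph_def)
    with less.prems(1) show ?thesis by blast
  next
    case False
    then obtain u' v' where "u' \<in> verts H" "v' \<in> verts H" "f u' = f v'" "u' \<noteq> v'"
      by (auto simp: inj_on_def)
    \<comment> \<open>A path joining two distinct vertices of one fibre is nonempty, and its first
      step is an edge to contract.\<close>
    with conn[of u' v'] obtain u where "(u', u) \<in> {(x, y). {x, y} \<in> edges H \<and> f x = f y}"
      by (meson converse_rtranclE)
    then obtain u v where uv: "{u, v} \<in> edges H" "f u = f v" by blast
    note uv' = edgeD[OF uv(1)]
    define g where "g w = (if w = v then u else w)" for w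
    define H' where "H' = contract_edge u v H"
    have vH': "verts H' = verts H - {v}"
      and eH': "edges H' = (\<lambda>e. g ` e) ` edges H - {{u}}"
      by (simp_all add: H'_def contract_edge_def g_def)
    have fg: "f (g w) = f w" for w using uv(2) by (simp add: g_def)
    have gv: "g ` verts H \<subseteq> verts H'" using uv' by (auto simp: g_def vH')
    have edge_image: "{g x, g y} \<in> edges H' \<or> g x = g y" if "{x, y} \<in> edges H" for x y
    proof -
      have "{g x, g y} \<in> (\<lambda>e. g ` e) ` edges H" using that by (force intro: image_eqI[of _ _ "{x, y}"])
      then show ?thesis by (auto simp: eH' doubleton_eq_iff)
    qed
    show ?thesis
    proof (rule less.hyps)
      show "card (verts H') < card (verts H)"
        using fin uv' by (simp add: vH' card_Diff1_less del: card_Diff_insert card_Diff_singleton)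
      show "contracts_to S H'"
        unfolding H'_def using less.prems(1) uv(1) uv'(3) by (rule contracts_to.step)
      show "simple_graph H'"
        unfolding simple_graph_def
      proof (intro conjI ballI)
        show "finite (verts H')" using fin by (simp add: vH')
        fix e assume e: "e \<in> edges H'"
        then obtain d where d: "d \<in> edges H" "e = g ` d" "e \<noteq> {u}" by (auto simp: eH')
        then have "d \<subseteq> verts H" "card d = 2" using simple by (auto simp: simple_graph_def)
        then show "e \<subseteq> verts H'" using gv d(2) by blast
        obtain x y where xy: "d = {x, y}" "x \<noteq> y" using \<open>card d = 2\<close> by (metis card_2_iff)
        \<comment> \<open>Two distinct vertices are identified only if they are \<open>u\<close> and
          \<open>v\<close>, and then the image is the discarded loop \<open>{u}\<close>.\<close>
        then have "g x \<noteq> g y" using d(2,3) by (auto simp: g_def split: if_splits)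
        then show "card e = 2" using d(2) xy by simp
      qed
      have "f ` verts H' = f ` verts H"
      proof
        show "f ` verts H \<subseteq> f ` verts H'" using gv fg by (metis image_subset_iff image_eqI)
      qed (auto simp: vH')
      then show "f ` verts H' = {..<t}" using surj by simp
      \<comment> \<open>Vertices with different labels are never identified, so this edge does not
        collapse.\<close>
      show "\<exists>x y. {x, y} \<in> edges H' \<and> f x = i \<and> f y = j" if "i < j" "j < t" for i j
        using adj[OF that] edge_image fg that by (metis less_irrefl)
      show "(a, b) \<in> {(x, y). {x, y} \<in> edges H' \<and> f x = f y}\<^sup>*" (is "_ \<in> ?R\<^sup>*")
        if "a \<in> verts H'" "b \<in> verts H'" "f a = f b" for a b
      proof -
        \<comment> \<open>Under \<open>g\<close> each step of a path is either kept as a step or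
          becomes stationary.\<close>
        have "(g a, g b) \<in> ?R\<^sup>*" if "(a, b) \<in> {(x, y). {x, y} \<in> edges H \<and> f x = f y}\<^sup>*" for a b
          using that
        proof induction
          case (step y z)
          then have "g y = g z \<or> (g y, g z) \<in> ?R" using edge_image fg by auto
          with step.IH show ?case by (auto intro: rtrancl_into_rtrancl)
        qed simp
        moreover have "g a = a" "g b = b" using that by (auto simp: g_def vH')
        moreover have "(a, b) \<in> {(x, y). {x, y} \<in> edges H \<and> f x = f y}\<^sup>*"
          using conn[of a b] that by (simp add: vH')
        ultimately show ?thesis by (metis (lifting))
      qed
    qed
  qed
qed

text \<open>Connectivity of a fibre is certified by descent: passing repeatedly to a smaller
  neighbour with the same label ends at the root.\<close>

lemma complete_graph_minor_of_labelling:
  fixes G :: "nat ugraph" and f :: "nat \<Rightarrow> nat"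
  assumes simple: "simple_graph G"
    and root: "\<And>i. i < t \<Longrightarrow> r i \<in> verts G \<and> f (r i) = i"
    and parent: "\<And>n. n \<in> verts G \<Longrightarrow> n = r (f n) \<or> (\<exists>m<n. {m, n} \<in> edges G \<and> f m = f n)"
    and adj: "\<And>i j. i < j \<Longrightarrow> j < t \<Longrightarrow> \<exists>x y. {x, y} \<in> edges G \<and> f x = i \<and> f y = j"
  shows "is_minor (complete_graph t) G"
proof -
  \<comment> \<open>Labels of \<open>t\<close> or more may occur; those fibres are deleted before
    contracting.\<close>
  define S where "S = Graph {v \<in> verts G. f v < t} {e \<in> edges G. \<forall>v\<in>e. f v < t}"
  have vS: "verts S = {v \<in> verts G. f v < t}"
    and eS: "edges S = {e \<in> edges G. \<forall>v\<in>e. f v < t}" by (simp_all add: S_def)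
  have simpleS: "simple_graph S"
    using simple by (auto simp: simple_graph_def vS eS)
  have sub: "subgraph S G" using simpleS by (auto simp: subgraph_def vS eS)
  let ?R = "{(x, y). {x, y} \<in> edges S \<and> f x = f y}"
  have to_root: "(r (f n), n) \<in> ?R\<^sup>*" if "n \<in> verts S" for n
    using that
  proof (induction n rule: less_induct)
    case (less n)
    from parent[of n] less.prems consider "n = r (f n)"
      | m where "m < n" "{m, n} \<in> edges G" "f m = f n" by (auto simp: vS)
    then show ?case
    proof cases
      case 2
      then have "m \<in> verts S" "(m, n) \<in> ?R"
        using less.prems simple by (auto simp: vS eS simple_graph_def)
      with less.IH[of m] 2 show ?thesis by (auto intro: rtrancl_into_rtrancl)
    qed auto
  qed
  have "sym ?R" by (auto simp: sym_def insert_commute)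
  have "\<exists>K. contracts_to S K \<and> graph_iso (complete_graph t) K"
  proof (rule contracts_to_complete_graph[OF contracts_to.refl simpleS])
    show "f ` verts S = {..<t}" using root by (force simp: vS)
    show "(u, v) \<in> ?R\<^sup>*" if "u \<in> verts S" "v \<in> verts S" "f u = f v" for u v
    proof -
      have "(u, r (f u)) \<in> ?R\<^sup>*"
        using sym_rtrancl[OF \<open>sym ?R\<close>] to_root[OF that(1)] by (rule symD)
      also have "(r (f u), v) \<in> ?R\<^sup>*" using to_root[OF that(2)] that(3) by simp
      finally show ?thesis .
    qed
    show "\<exists>x y. {x, y} \<in> edges S \<and> f x = i \<and> f y = j" if "i < j" "j < t" for i j
      using adj[OF that] that by (auto simp: eS) (metis less_trans)
  qed
  with sub show ?thesis by (auto simp: is_minor_def)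
qed

section \<open>Construction of the graph from spines and links\<close>

text \<open>The link between spines \<open>i < j\<close> lies in the block of length \<open>2\<^bsup>T + 1\<^esup>\<close> with index
  \<open>T * j + i\<close>. It starts on spine \<open>j\<close> and ends on spine \<open>i\<close>.\<close>

definition link_start :: "nat \<Rightarrow> nat \<Rightarrow> nat \<Rightarrow> nat" where
  "link_start T i j = (T * j + i) * 2 ^ Suc T + 2 ^ Suc j"

text \<open>For \<open>i < j\<close>, adding \<open>2 ^ Suc i\<close> to a number of valuation
  \<open>j + 1\<close> gives valuation \<open>i + 1\<close>, which puts the end on spine
  \<open>i\<close>.\<close>

definition link_end :: "nat \<Rightarrow> nat \<Rightarrow> nat \<Rightarrow> nat" where
  "link_end T i j = link_start T i j + 2 ^ Suc i"

definition spine_verts :: "nat \<Rightarrow> nat set" where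
  "spine_verts T = {n. n < T * T * 2 ^ Suc T \<and> (\<exists>k<T. dyadic_level (Suc k) n)}"

definition link_verts :: "nat \<Rightarrow> nat set" where
  "link_verts T = {n. odd n \<and> (\<exists>i j. i < j \<and> j < T \<and> link_start T i j < n \<and> n < link_end T i j)}"

definition spine_edges :: "nat \<Rightarrow> nat set set" where
  "spine_edges T = {{n, n + 2 ^ Suc (Suc k)} | n k.
     k < T \<and> dyadic_level (Suc k) n \<and> n + 2 ^ Suc (Suc k) < T * T * 2 ^ Suc T}"

text \<open>For \<open>i = 0\<close> the link has a single interior vertex, lying on both listed
  edges, and the last family is empty.\<close>

definition link_edges :: "nat \<Rightarrow> nat \<Rightarrow> nat \<Rightarrow> nat set set" where
  "link_edges T i j = {{link_start T i j, Suc (link_start T i j)}, {link_end T i j - 1, link_end T i j}} \<union>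
     {{n, n + 2} | n. odd n \<and> link_start T i j < n \<and> n + 2 < link_end T i j}"

definition spine_graph :: "nat \<Rightarrow> nat ugraph" where
  "spine_graph T = Graph (spine_verts T \<union> link_verts T)
     (spine_edges T \<union> \<Union>{link_edges T i j | i j. i < j \<and> j < T})"

text \<open>Interior vertices of a link join the branch set of \<open>j\<close>: dividing by the
  block length gives \<open>T * j + i\<close>, and dividing that by \<open>T\<close> gives
  \<open>j\<close>. Even vertices lie on spines.\<close>

definition spine_label :: "nat \<Rightarrow> nat \<Rightarrow> nat" where
  "spine_label T n = (if even n then multiplicity 2 n - 1 else n div 2 ^ Suc T div T)"

lemma dyadic_level_Suc_even: "dyadic_level (Suc k) n \<Longrightarrow> even n"
  using dyadic_level_dvd[of "Suc k" n 1] by simp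

lemma spine_label_level: "dyadic_level (Suc k) n \<Longrightarrow> spine_label T n = k"
  by (simp add: spine_label_def dyadic_level_Suc_even dyadic_level_multiplicity)

context
  fixes T i j :: nat
  assumes ij: "i < j" "j < T"
begin

lemma block_le: "T * j + i < T * T"
proof -
  have "T * j + i < T * Suc j" using ij by simp
  also have "\<dots> \<le> T * T" using ij by (intro mult_le_mono2) simp
  finally show ?thesis .
qed

text \<open>The sum is below \<open>2 ^ (j + 2)\<close>, and \<open>j < T\<close>. This keeps each
  link inside its own block.\<close>

lemma link_end_offset_less: "2 ^ Suc j + 2 ^ Suc i < (2::nat) ^ Suc T"
proof -
  have "(2::nat) ^ Suc i < 2 ^ Suc j" using ij by (intro power_strict_increasing) auto
  moreover have "(2::nat) ^ Suc (Suc j) \<le> 2 ^ Suc T" using ij by (intro power_increasing) auto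
  moreover have "(2::nat) ^ Suc (Suc j) = 2 ^ Suc j + 2 ^ Suc j" by simp
  ultimately show ?thesis by linarith
qed

lemma link_div:
  assumes "link_start T i j \<le> n" "n \<le> link_end T i j"
  shows "n div 2 ^ Suc T = T * j + i"
proof -
  define r where "r = n - (T * j + i) * 2 ^ Suc T"
  have "n = (T * j + i) * 2 ^ Suc T + r" "r < 2 ^ Suc T"
    using assms link_end_offset_less by (auto simp: link_start_def link_end_def r_def)
  then show ?thesis by (simp del: power_Suc)
qed

lemma link_end_less: "link_end T i j < T * T * 2 ^ Suc T"
proof -
  have "link_end T i j < (T * j + i) * 2 ^ Suc T + 2 ^ Suc T"
    using link_end_offset_less by (simp add: link_start_def link_end_def)
  also have "\<dots> = Suc (T * j + i) * 2 ^ Suc T" by simp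
  also have "\<dots> \<le> T * T * 2 ^ Suc T" using block_le by (intro mult_le_mono1) simp
  finally show ?thesis .
qed

text \<open>The block length is a multiple of \<open>2 ^ (j + 2)\<close>, so the position of the
  block does not affect the residue that determines the level.\<close>

lemma dyadic_level_link_start: "dyadic_level (Suc j) (link_start T i j)"
proof -
  have "(2::nat) ^ Suc (Suc j) dvd 2 ^ Suc T" using ij by (intro le_imp_power_dvd) simp
  then have "(2::nat) ^ Suc (Suc j) dvd (T * j + i) * 2 ^ Suc T" by (rule dvd_mult)
  then obtain q where "(T * j + i) * 2 ^ Suc T = q * 2 ^ Suc (Suc j)" by (metis dvd_def mult.commute)
  then show ?thesis unfolding dyadic_level_iff link_start_def by metis
qed

lemma dyadic_level_link_end: "dyadic_level (Suc i) (link_end T i j)"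
proof -
  have "2 ^ Suc (Suc i) dvd link_start T i j"
    using dyadic_level_link_start ij by (intro dyadic_level_dvd[of "Suc j"]) auto
  then obtain q where "link_start T i j = q * 2 ^ Suc (Suc i)" by (metis dvd_def mult.commute)
  then show ?thesis unfolding dyadic_level_iff link_end_def by metis
qed

lemma even_link_start: "even (link_start T i j)"
  using dyadic_level_link_start by (rule dyadic_level_Suc_even)

lemma even_link_end: "even (link_end T i j)"
  using dyadic_level_link_end by (rule dyadic_level_Suc_even)

lemma link_start_less_end: "Suc (link_start T i j) < link_end T i j"
proof -
  have "(2::nat) ^ Suc i \<ge> 2" by simp
  then show ?thesis by (simp only: link_end_def)
qed

lemma link_start_in_spine: "link_start T i j \<in> spine_verts T"
  using ij dyadic_level_link_start link_end_less link_start_less_end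
  by (auto simp: spine_verts_def simp del: power_Suc)

lemma link_end_in_spine: "link_end T i j \<in> spine_verts T"
  unfolding spine_verts_def using ij dyadic_level_link_end link_end_less
  by (intro CollectI conjI exI[of _ i]) auto

lemma link_vertsI: "odd n \<Longrightarrow> link_start T i j < n \<Longrightarrow> n < link_end T i j \<Longrightarrow> n \<in> link_verts T"
  using ij by (auto simp: link_verts_def)

lemma spine_label_link: "odd n \<Longrightarrow> link_start T i j < n \<Longrightarrow> n < link_end T i j \<Longrightarrow> spine_label T n = j"
  using link_div[of n] ij by (simp add: spine_label_def del: power_Suc)

lemma link_edge_verts:
  assumes "e \<in> link_edges T i j"
  shows "e \<subseteq> spine_verts T \<union> link_verts T \<and> card e = 2"
proof -
  consider "e = {link_start T i j, Suc (link_start T i j)}" | "e = {link_end T i j - 1, link_end T i j}"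
    | n where "e = {n, n + 2}" "odd n" "link_start T i j < n" "n + 2 < link_end T i j"
    using assms by (auto simp: link_edges_def)
  then show ?thesis
  proof cases
    case 1
    then show ?thesis
      using link_start_in_spine link_start_less_end even_link_start
      by (auto intro!: link_vertsI)
  next
    case 2
    then show ?thesis
      using link_end_in_spine link_start_less_end even_link_end
      by (auto intro!: link_vertsI simp: card_insert_if)
  next
    case 3
    then show ?thesis by (auto intro!: link_vertsI)
  qed
qed

end

text \<open>Different pairs have disjoint blocks, since \<open>T * j + i\<close> with
  \<open>i < T\<close> determines both indices; a common vertex thus identifies the link.\<close>

lemma link_unique:
  assumes "i < j" "j < T" "i' < j'" "j' < T"
    "link_start T i j \<le> n" "n \<le> link_end T i j"
    "link_start T i' j' \<le> n" "n \<le> link_end T i' j'"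
  shows "i = i' \<and> j = j'"
proof -
  have eq: "T * j + i = T * j' + i'"
    using link_div[of i j T n] link_div[of i' j' T n] assms by simp
  have "j = (T * j + i) div T" "j' = (T * j' + i') div T" using assms by auto
  with eq show ?thesis by simp
qed

lemma verts_spine_graph: "verts (spine_graph T) = spine_verts T \<union> link_verts T"
  by (simp add: spine_graph_def)

lemma edges_spine_graph_cases:
  assumes "e \<in> edges (spine_graph T)"
  obtains (spine) n k where "e = {n, n + 2 ^ Suc (Suc k)}" "k < T" "dyadic_level (Suc k) n"
      "n + 2 ^ Suc (Suc k) < T * T * 2 ^ Suc T"
    | (start) i j where "i < j" "j < T" "e = {link_start T i j, Suc (link_start T i j)}"
    | (finish) i j where "i < j" "j < T" "e = {link_end T i j - 1, link_end T i j}"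
    | (inner) i j n where "i < j" "j < T" "e = {n, n + 2}" "odd n" "link_start T i j < n"
      "n + 2 < link_end T i j"
  using assms unfolding spine_graph_def spine_edges_def link_edges_def ugraph.sel by blast

lemma spine_graph_edgeI:
  assumes "dyadic_level (Suc k) n" "k < T" "n + 2 ^ Suc (Suc k) < T * T * 2 ^ Suc T"
  shows "{n, n + 2 ^ Suc (Suc k)} \<in> edges (spine_graph T)"
  using assms unfolding spine_graph_def spine_edges_def ugraph.sel by blast

lemma spine_graph_linkI:
  assumes "i < j" "j < T" "e \<in> link_edges T i j"
  shows "e \<in> edges (spine_graph T)"
  using assms unfolding spine_graph_def ugraph.sel by blast

lemma simple_spine_graph: "simple_graph (spine_graph T)"
  unfolding simple_graph_def
proof (intro conjI ballI)
  have "spine_verts T \<union> link_verts T \<subseteq> {..<T * T * 2 ^ Suc T}"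
    using link_end_less by (fastforce simp: spine_verts_def link_verts_def simp del: power_Suc)
  then show "finite (verts (spine_graph T))"
    unfolding verts_spine_graph by (rule finite_subset) simp
  fix e assume "e \<in> edges (spine_graph T)"
  then consider n k where "e = {n, n + 2 ^ Suc (Suc k)}" "k < T" "dyadic_level (Suc k) n"
      "n + 2 ^ Suc (Suc k) < T * T * 2 ^ Suc T"
    | i j where "i < j" "j < T" "e \<in> link_edges T i j"
    unfolding spine_graph_def spine_edges_def ugraph.sel by blast
  then have "e \<subseteq> spine_verts T \<union> link_verts T \<and> card e = 2"
  proof cases
    case 1
    then have "dyadic_level (Suc k) (n + 2 ^ Suc (Suc k))" by (simp only: dyadic_level_add)
    with 1 show ?thesis by (auto simp: spine_verts_def simp del: power_Suc)
  qed (rule link_edge_verts)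
  then show "e \<subseteq> verts (spine_graph T)" "card e = 2" by (simp_all add: verts_spine_graph)
qed

section \<open>Degeneracy and the complete minor for the constructed graph\<close>

lemma degenerate_crossing_spine_graph:
  "degenerate 2 (crossing_graph (spine_graph T) circle_point)"
proof (rule degenerate_crossing_graph_dyadic)
  fix e assume "e \<in> edges (spine_graph T)"
  then show "(\<exists>n. e = {n, Suc n}) \<or> (\<exists>k n. dyadic_level k n \<and> e = {n, n + 2 ^ Suc k})"
  proof (cases rule: edges_spine_graph_cases)
    case (finish i j)
    then have "e = {link_end T i j - 1, Suc (link_end T i j - 1)}"
      using link_start_less_end[OF finish(1,2)] by simp
    then show ?thesis by blast
  next
    case (inner i j n)
    then have "dyadic_level 0 n \<and> e = {n, n + 2 ^ Suc 0}"
      by (simp add: dyadic_level_def odd_iff_mod_2_eq_one)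
    then show ?thesis by blast
  qed blast+
qed

text \<open>Spine \<open>k\<close> is rooted at \<open>2 ^ Suc k\<close>, the least number of its
  level. Spine vertices descend by \<open>2 ^ (k + 2)\<close>, link vertices by 2 or, at the first
  one, by 1 to the link start. The last edge of a link joins labels \<open>j\<close> and
  \<open>i\<close>.\<close>

lemma spine_graph_minor:
  assumes "t \<le> T"
  shows "is_minor (complete_graph t) (spine_graph T)"
proof (rule complete_graph_minor_of_labelling[OF simple_spine_graph])
  fix k assume "k < t"
  then have "k < T" using assms by simp
  have lev: "dyadic_level (Suc k) (2 ^ Suc k)" by (auto simp: dyadic_level_def)
  have "(2::nat) ^ Suc k < 2 ^ Suc T" using \<open>k < T\<close> by (intro power_strict_increasing) auto
  also have "\<dots> \<le> T * T * 2 ^ Suc T" using \<open>k < T\<close> by simp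
  finally show "2 ^ Suc k \<in> verts (spine_graph T) \<and> spine_label T (2 ^ Suc k) = k"
    using spine_label_level[OF lev] lev \<open>k < T\<close>
    by (auto simp: verts_spine_graph spine_verts_def simp del: power_Suc)
next
  fix n assume "n \<in> verts (spine_graph T)"
  then consider k where "n < T * T * 2 ^ Suc T" "k < T" "dyadic_level (Suc k) n"
    | i j where "i < j" "j < T" "odd n" "link_start T i j < n" "n < link_end T i j"
    unfolding verts_spine_graph spine_verts_def link_verts_def by blast
  then show "n = 2 ^ Suc (spine_label T n) \<or>
      (\<exists>m<n. {m, n} \<in> edges (spine_graph T) \<and> spine_label T m = spine_label T n)"
  proof cases
    case 1
    have lab: "spine_label T n = k" using 1 by (intro spine_label_level)
    obtain q where q: "n = q * 2 ^ Suc (Suc k) + 2 ^ Suc k" using 1 dyadic_level_iff by blast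
    show ?thesis
    proof (cases q)
      case 0
      then show ?thesis using q lab by simp
    next
      case (Suc q')
      define m where "m = q' * 2 ^ Suc (Suc k) + 2 ^ Suc k"
      have n: "n = m + 2 ^ Suc (Suc k)" using q Suc by (simp add: m_def)
      have lev: "dyadic_level (Suc k) m" unfolding dyadic_level_iff m_def by blast
      have "{m, n} \<in> edges (spine_graph T)"
        unfolding n using lev 1(1,2) n by (intro spine_graph_edgeI) auto
      moreover have "m < n" using n by simp
      moreover have "spine_label T m = k" using lev by (rule spine_label_level)
      ultimately show ?thesis using lab by (intro disjI2 exI[of _ m]) simp
    qed
  next
    case 2
    note ij = 2(1,2)
    have lab: "spine_label T n = j" using spine_label_link 2 by blast
    show ?thesis
    proof (cases "n = Suc (link_start T i j)")
      case True
      have "{link_start T i j, n} \<in> edges (spine_graph T)"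
        using True by (intro spine_graph_linkI[OF ij]) (auto simp: link_edges_def)
      moreover have "spine_label T (link_start T i j) = j"
        using dyadic_level_link_start[OF ij] by (rule spine_label_level)
      ultimately show ?thesis using lab 2(4) by (intro disjI2 exI[of _ "link_start T i j"]) simp
    next
      case False
      \<comment> \<open>The number \<open>link_start T i j + 2\<close> is even and \<open>n\<close>
        is odd, so the inequality is strict and \<open>n - 2\<close> is still interior.\<close>
      then have gt: "link_start T i j + 2 < n"
        using 2 even_link_start[OF ij] by (cases "n = link_start T i j + 2") auto
      define m where "m = n - 2"
      have m: "n = m + 2" "odd m" "link_start T i j < m" "m < n" using gt 2(3) by (auto simp: m_def)
      have "{m, n} \<in> edges (spine_graph T)"
        using m 2 by (intro spine_graph_linkI[OF ij]) (auto simp: link_edges_def)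
      moreover have "spine_label T m = j" using m 2 by (intro spine_label_link[OF ij]) auto
      ultimately show ?thesis using lab m(4) by (intro disjI2 exI[of _ m]) simp
    qed
  qed
next
  fix i j assume "i < j" "j < t"
  then have ij: "i < j" "j < T" using assms by auto
  have "{link_end T i j, link_end T i j - 1} \<in> edges (spine_graph T)"
    by (intro spine_graph_linkI[OF ij]) (auto simp: link_edges_def)
  moreover have "spine_label T (link_end T i j) = i"
    using dyadic_level_link_end[OF ij] by (rule spine_label_level)
  moreover have "spine_label T (link_end T i j - 1) = j"
    using link_start_less_end[OF ij] even_link_end[OF ij]
    by (intro spine_label_link[OF ij]) auto
  ultimately show "\<exists>x y. {x, y} \<in> edges (spine_graph T) \<and> spine_label T x = i \<and> spine_label T y = j"
    by blast
qed

section \<open>Vertex degrees\<close>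

lemma spine_graph_short_edge:
  assumes "{m, Suc m} \<in> edges (spine_graph T)"
  shows "\<exists>i j. i < j \<and> j < T \<and> (m = link_start T i j \<or> Suc m = link_end T i j)"
  using assms
proof (cases rule: edges_spine_graph_cases)
  case (spine n k)
  moreover have "(2::nat) ^ Suc (Suc k) \<ge> 2" by simp
  ultimately show ?thesis by (auto simp: doubleton_eq_iff simp del: power_Suc)
next
  case (finish i j)
  then show ?thesis using link_start_less_end[OF finish(1,2)] by (auto simp: doubleton_eq_iff)
qed (auto simp: doubleton_eq_iff)

lemma spine_graph_inner_edge:
  assumes "{m, m + 2} \<in> edges (spine_graph T)" "odd m"
  shows "\<exists>i j. i < j \<and> j < T \<and> link_start T i j < m \<and> m + 2 < link_end T i j"
  using assms(1)
proof (cases rule: edges_spine_graph_cases)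
  case (spine n k)
  then have "even n" "even (n + 2 ^ Suc (Suc k))" using dyadic_level_Suc_even by auto
  with spine(1) assms(2) show ?thesis by (auto simp: doubleton_eq_iff simp del: power_Suc)
qed (auto simp: doubleton_eq_iff)

text \<open>Dyadic edges at \<open>n\<close> have the length fixed by its valuation, at most one on
  each side; all other edges join consecutive numbers.\<close>

lemma spine_graph_incident_edge:
  assumes "e \<in> edges (spine_graph T)" "n \<in> e"
  defines "d \<equiv> 2 ^ Suc (multiplicity 2 n)"
  shows "e \<in> {{n - d, n}, {n, n + d}, {n - 1, n}, {n, Suc n}}"
proof -
  have long: "e \<in> {{n - d, n}, {n, n + d}}" if e: "e = {m, m + 2 ^ Suc k}" and lev: "dyadic_level k m" for m k
  proof -
    have "dyadic_level k n" using assms(2) e lev dyadic_level_add by auto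
    then have "d = 2 ^ Suc k" using dyadic_level_multiplicity d_def by simp
    then show ?thesis using assms(2) e by auto
  qed
  show ?thesis using assms(1)
  proof (cases rule: edges_spine_graph_cases)
    case (spine m k)
    then show ?thesis using long by blast
  next
    case (start i j)
    then show ?thesis using assms(2) by auto
  next
    case (finish i j)
    moreover obtain m where "link_end T i j = Suc m"
      using link_start_less_end[OF finish(1,2)] by (cases "link_end T i j") auto
    ultimately have "n = m \<or> n = Suc m" "e = {m, Suc m}" using assms(2) by auto
    then show ?thesis by (elim disjE) simp_all
  next
    case (inner i j m)
    then have "dyadic_level 0 m" "e = {m, m + 2 ^ Suc 0}"
      by (simp_all add: dyadic_level_def odd_iff_mod_2_eq_one)
    then show ?thesis using long by blast
  qed
qed

text \<open>One of the four candidates is always missing: an even vertex cannot be both the end of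
  one link and the start of another, and the first interior vertex of a link has no inner edge to
  its left.\<close>

lemma vertex_degree_spine_graph_le: "vertex_degree (spine_graph T) n \<le> 3"
proof -
  define d :: nat where "d = 2 ^ Suc (multiplicity 2 n)"
  let ?E = "edges (spine_graph T)" and ?I = "{e \<in> edges (spine_graph T). n \<in> e}"
  have I: "?I \<subseteq> {{n - d, n}, {n, n + d}, {n - 1, n}, {n, Suc n}}"
    using spine_graph_incident_edge unfolding d_def by blast
  have "{n - d, n} \<notin> ?E \<or> {n - 1, n} \<notin> ?E \<or> {n, Suc n} \<notin> ?E"
  proof (rule ccontr)
    assume "\<not> ?thesis"
    then have E: "{n - d, n} \<in> ?E" "{n - 1, n} \<in> ?E" "{n, Suc n} \<in> ?E" by auto
    \<comment> \<open>Subtraction is truncated: at \<open>n = 0\<close> this set would be a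
      singleton and not an edge.\<close>
    have "card {n - 1, n} = 2" using E(2) simple_spine_graph[of T] by (simp only: simple_graph_def)
    then have "n \<noteq> 0" by (cases n) auto
    then have "Suc (n - 1) = n" by simp
    then obtain i j where ij: "i < j" "j < T" and n: "n - 1 = link_start T i j \<or> n = link_end T i j"
      using spine_graph_short_edge[of "n - 1" T] E(2) by auto
    note facts = even_link_start[OF ij] even_link_end[OF ij] link_start_less_end[OF ij]
    show False
    proof (cases "even n")
      case True
      then have "n = link_end T i j" using n facts \<open>Suc (n - 1) = n\<close> by (metis even_Suc)
      obtain i' j' where ij': "i' < j'" "j' < T" "n = link_start T i' j' \<or> Suc n = link_end T i' j'"
        using spine_graph_short_edge[OF E(3)] by blast
      then have n': "n = link_start T i' j'" using True even_link_end[OF ij'(1,2)] by (metis even_Suc)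
      then have "i = i' \<and> j = j'"
        using link_start_less_end[OF ij'(1,2)] facts \<open>n = link_end T i j\<close>
        by (intro link_unique[OF ij ij'(1,2), of n]) auto
      then show False using n' \<open>n = link_end T i j\<close> facts by simp
    next
      case False
      then have ns: "n = Suc (link_start T i j)" using n facts \<open>Suc (n - 1) = n\<close> by metis
      \<comment> \<open>An odd \<open>n\<close> has valuation 0, so the left edge goes to
        \<open>n - 2\<close>, a true difference as \<open>n\<close> is at least 3. It would be an
        inner edge of the same link, although \<open>n - 2\<close> precedes the link start.\<close>
      have "d = 2" using False by (simp add: d_def not_dvd_imp_multiplicity_0)
      have "(2::nat) ^ Suc j \<ge> 2" by simp
      then have "link_start T i j \<ge> 2" unfolding link_start_def by linarith
      then have "n = n - 2 + 2" using ns by linarith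
      moreover have "odd (n - 2)" using False calculation by (metis even_add even_numeral)
      ultimately obtain i' j' where ij': "i' < j'" "j' < T" "link_start T i' j' < n - 2" "n < link_end T i' j'"
        using spine_graph_inner_edge[of "n - 2" T] E(1) \<open>d = 2\<close> by auto
      then have "i = i' \<and> j = j'"
        using facts ns by (intro link_unique[OF ij ij'(1,2), of n]) auto
      then show False using ij'(3) ns by simp
    qed
  qed
  then have "\<exists>e\<in>{{n - d, n}, {n, n + d}, {n - 1, n}, {n, Suc n}}. e \<notin> ?E" (is "\<exists>e\<in>?X. _")
    by (elim disjE) simp_all
  then obtain e where e: "e \<in> ?X" "e \<notin> ?E" by (rule bexE)
  have "card ?I \<le> card (?X - {e})"
    using I e(2) by (intro card_mono) (simp_all add: subset_Diff_insert)
  also have "\<dots> = card ?X - 1" using e(1) by (rule card_Diff_singleton)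
  also have "\<dots> \<le> 3"
    using card_length[of "[{n - d, n}, {n, n + d}, {n - 1, n}, {n, Suc n}]"] by simp
  finally show ?thesis unfolding vertex_degree_def .
qed

text \<open>The bound 3 is attained by two spine edges and the first link edge. Both spine edges
  fit: \<open>j > 0\<close> leaves a full block to the left, and \<open>i + 2 \<le> T\<close> leaves
  one to the right.\<close>

lemma vertex_degree_link_start:
  assumes ij: "i < j" "j < T"
  shows "vertex_degree (spine_graph T) (link_start T i j) = 3"
proof (rule antisym[OF vertex_degree_spine_graph_le])
  let ?n = "link_start T i j"
  define d :: nat where "d = 2 ^ Suc (Suc j)"
  \<comment> \<open>Keeps \<open>?n + 1\<close> and \<open>?n + d\<close> apart when the three edges
    are counted.\<close>
  have "d \<ge> 4" by (simp add: d_def)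
  have "d \<le> 2 ^ Suc T" unfolding d_def using ij by (intro power_increasing) auto
  have "T * j + i > 0" using ij by simp
  have "d \<le> 1 * 2 ^ Suc T" using \<open>d \<le> 2 ^ Suc T\<close> by (simp only: mult_1)
  also have "\<dots> \<le> (T * j + i) * 2 ^ Suc T"
    using \<open>T * j + i > 0\<close> by (intro mult_le_mono1) linarith
  finally have "d \<le> ?n" unfolding link_start_def by (rule trans_le_add1)
  have lev: "dyadic_level (Suc j) ?n" by (rule dyadic_level_link_start[OF ij])
  have "T * j + i + 2 \<le> T * Suc j" using ij by simp
  also have "\<dots> \<le> T * T" using ij by (intro mult_le_mono2) simp
  finally have "(T * j + i + 2) * 2 ^ Suc T \<le> T * T * 2 ^ Suc T" by (rule mult_le_mono1)
  moreover have "?n + d < (T * j + i + 2) * 2 ^ Suc T"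
  proof -
    have "2 ^ Suc j + d < 2 * 2 ^ Suc T"
      using link_end_offset_less[OF ij] \<open>d \<le> 2 ^ Suc T\<close> by linarith
    then have "(T * j + i) * 2 ^ Suc T + (2 ^ Suc j + d) < (T * j + i) * 2 ^ Suc T + 2 * 2 ^ Suc T"
      by (rule add_strict_left_mono)
    then show ?thesis
      by (simp only: link_start_def distrib_right[of "T * j + i" 2] add.assoc[of _ "2 ^ Suc j"])
  qed
  ultimately have less: "?n + d < T * T * 2 ^ Suc T" by linarith
  have "{?n, ?n + d} \<in> edges (spine_graph T)"
    unfolding d_def using lev ij less d_def by (intro spine_graph_edgeI) auto
  moreover have "{?n - d, ?n} \<in> edges (spine_graph T)"
  proof -
    have n: "?n = ?n - d + d" using \<open>d \<le> ?n\<close> by simp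
    have "dyadic_level (Suc j) (?n - d)" using lev n dyadic_level_add[of "Suc j" "?n - d"] d_def by simp
    then have "{?n - d, ?n - d + d} \<in> edges (spine_graph T)"
      unfolding d_def using ij less n d_def by (intro spine_graph_edgeI) auto
    with n show ?thesis by simp
  qed
  moreover have "{?n, Suc ?n} \<in> edges (spine_graph T)"
    by (intro spine_graph_linkI[OF ij]) (auto simp: link_edges_def)
  ultimately have sub: "{{?n - d, ?n}, {?n, ?n + d}, {?n, Suc ?n}} \<subseteq> {e \<in> edges (spine_graph T). ?n \<in> e}"
    by auto
  have "edges (spine_graph T) \<subseteq> Pow (verts (spine_graph T))" "finite (verts (spine_graph T))"
    using simple_spine_graph[of T] by (auto simp: simple_graph_def)
  then have "finite (edges (spine_graph T))" by (meson finite_Pow_iff finite_subset)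
  then have "card {{?n - d, ?n}, {?n, ?n + d}, {?n, Suc ?n}} \<le> vertex_degree (spine_graph T) ?n"
    unfolding vertex_degree_def using sub by (intro card_mono) auto
  moreover have "card {{?n - d, ?n}, {?n, ?n + d}, {?n, Suc ?n}} = 3"
    using \<open>d \<ge> 4\<close> \<open>d \<le> ?n\<close> by (auto simp: card_insert_if doubleton_eq_iff)
  ultimately show "3 \<le> vertex_degree (spine_graph T) ?n" by simp
qed

lemma max_degree_spine_graph:
  assumes "2 \<le> T"
  shows "max_degree (spine_graph T) = 3"
proof -
  have 01: "0 < (1::nat)" "1 < T" using assms by auto
  have fin: "finite (verts (spine_graph T))" using simple_spine_graph by (simp add: simple_graph_def)
  have "link_start T 0 1 \<in> verts (spine_graph T)"
    using link_start_in_spine[OF 01] by (simp add: verts_spine_graph)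
  then have "3 \<in> vertex_degree (spine_graph T) ` verts (spine_graph T)"
    using vertex_degree_link_start[OF 01] by (metis image_eqI)
  then show ?thesis
    unfolding max_degree_def using fin vertex_degree_spine_graph_le
    by (intro Max_eqI) auto
qed

theorem theorem19:
  "\<forall>t::nat. \<exists>(G :: nat ugraph) (D :: nat \<Rightarrow> complex).
     simple_graph G \<and> circular_drawing G D \<and>
     is_minor (complete_graph t) G \<and>
     max_degree G = 3 \<and>
     degenerate 2 (crossing_graph G D)"
proof
  fix t :: nat
  \<comment> \<open>The two extra spines ensure that the link between spines 0 and 1 exists for
    every \<open>t\<close>, so that degree 3 occurs.\<close>
  let ?G = "spine_graph (t + 2)"
  have "circular_drawing ?G circle_point"
    unfolding circular_drawing_def
  proof
    show "inj_on circle_point (verts ?G)" using inj_circle_point by (rule inj_on_subset) simp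
    show "\<exists>c r. r > 0 \<and> circle_point ` verts ?G \<subseteq> sphere c r"
      using circle_point_in_sphere by (intro exI[of _ "Complex (1/2) 0"] exI[of _ "1/2"]) auto
  qed
  moreover have "is_minor (complete_graph t) ?G" "max_degree ?G = 3"
    by (simp_all add: spine_graph_minor max_degree_spine_graph)
  ultimately show "\<exists>(G :: nat ugraph) D. simple_graph G \<and> circular_drawing G D \<and>
      is_minor (complete_graph t) G \<and> max_degree G = 3 \<and> degenerate 2 (crossing_graph G D)"
    using simple_spine_graph degenerate_crossing_spine_graph by blast
qed

end
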